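(* Let $d \geq 1$, let $S$ be a finite set, let $0 \in S$, and let $c : S^{\mathbb{Z}^d} \to S^{\mathbb{Z}^d}$ be a cellular automaton. If $c$ is asymptotically $0$-nilpotent, then $c$ is $0$-nilpotent.
   Context: $S^{\mathbb{Z}^d}$ carries the product topology of the discrete topology on the finite set $S$. For $v \in \mathbb{Z}^d$ the shift $\sigma^v : S^{\mathbb{Z}^d} \to S^{\mathbb{Z}^d}$ is defined by $\sigma^v(x)_u = x_{u+v}$. A cellular automaton on $S^{\mathbb{Z}^d}$ is a continuous map $c : S^{\mathbb{Z}^d} \to S^{\mathbb{Z}^d}$ that commutes with $\sigma^v$ for all $v \in \mathbb{Z}^d$. $c^n$ denotes the $n$-fold iterate of $c$. $c$ is $0$-nilpotent if there exists $m \in \mathbb{N}$ such that for all $n \geq m$, all $x \in S^{\mathbb{Z}^d}$ and all $v \in \mathbb{Z}^d$, $c^n(x)_v = 0$. $c$ is asymptotically $0$-nilpotent if for all $x \in S^{\mathbb{Z}^d}$ and all $v \in \mathbb{Z}^d$ there exists $m \in \mathbb{N}$ such that for all $n \geq m$, $c^n(x)_v = 0$. *)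

theory Defs
  imports "HOL-Analysis.Analysis"
begin

(* Z^d is int ^ 'd for an index type 'd :: finite, so d = CARD('d) >= 1 is arbitrary. *)
type_synonym ('d, 's) config = "int ^ 'd \<Rightarrow> 's"

definition config_topology :: "('d::finite, 's::finite) config topology" where
  "config_topology = product_topology (\<lambda>_. discrete_topology UNIV) UNIV"

definition shift :: "int ^ 'd \<Rightarrow> ('d::finite, 's) config \<Rightarrow> ('d, 's) config" where
  "shift v x = (\<lambda>u. x (u + v))"

definition cellular_automaton ::
    "(('d::finite, 's::finite) config \<Rightarrow> ('d, 's) config) \<Rightarrow> bool" where
  "cellular_automaton c \<longleftrightarrow>
     continuous_map config_topology config_topology c \<and>
     (\<forall>v. c \<circ> shift v = shift v \<circ> c)"

definition nilpotent ::
    "'s \<Rightarrow> (('d::finite, 's::finite) config \<Rightarrow> ('d, 's) config) \<Rightarrow> bool" where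
  "nilpotent z c \<longleftrightarrow> (\<exists>m. \<forall>n\<ge>m. \<forall>x v. (c ^^ n) x v = z)"

definition asymptotically_nilpotent ::
    "'s \<Rightarrow> (('d::finite, 's::finite) config \<Rightarrow> ('d, 's) config) \<Rightarrow> bool" where
  "asymptotically_nilpotent z c \<longleftrightarrow> (\<forall>x v. \<exists>m. \<forall>n\<ge>m. (c ^^ n) x v = z)"

end

theory Submission
  imports Defs
begin

text \<open>
  Call a configuration mortal if it becomes zero everywhere after finitely many steps. The proof rests on
  one category argument, \<open>baire_quiet_pattern\<close>, used in two ways.

  Applied to all configurations, it yields a finite pattern that forces the cells near its centre to be zero
  from some time m on, whatever surrounds it (\<open>quiet_pattern_exists\<close>). Applied to the bounded mortal
  configurations only, it shows that a bounded mortal configuration which starts far enough from the origin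
  never reaches the origin (\<open>mortal_debris_misses\<close>).

  Suppose that the quiet pattern, surrounded by zeros, is mortal. Let g be any configuration that is zero on
  a large box. Planting the pattern in the middle of this box changes nothing in the long run, since the
  pattern dies without having met the rest; but the planted pattern forbids g to reach the origin. So a
  large empty box protects its centre forever. Every orbit has such an empty box at some time, and by
  compactness at a bounded time, which proves nilpotency (\<open>nilpotent_if_mortal_pattern\<close>).

  It remains to see that the pattern is mortal. This goes by induction on the set J of free directions,
  for configurations with a given period in all other directions, starting with no free direction.

  If J has at least two elements, repeat the pattern periodically along one of them. The result is mortal
  by induction, and the reasoning above shows that an empty tube along this direction protects its axis.
  The outside of any bounded configuration is swept by such tubes, so its orbit stays bounded; asymptotic
  nilpotency makes it mortal (\<open>bounded_mortal_several_directions\<close>).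

  If J has a single element, two copies of the pattern are walls that trap whatever lies between them, and
  what is trapped is mortal. So the debris which one copy sends towards the other is
  part of a mortal configuration, at least until the distant second copy makes itself felt. By
  \<open>mortal_debris_misses\<close> it cannot go far. So the debris of the pattern stays in a bounded region
  and dies (\<open>pattern_mortal_one_direction\<close>).
\<close>

section \<open>Locality and compactness\<close>

definition cube :: "int ^ 'd \<Rightarrow> int \<Rightarrow> (int ^ 'd) set" where
  "cube v s = {u. \<forall>i. \<bar>u $ i - v $ i\<bar> \<le> s}"

lemma cubeI: "(\<And>i. \<bar>u $ i - v $ i\<bar> \<le> s) \<Longrightarrow> u \<in> cube v s"
  by (simp add: cube_def)

lemma cubeD: "u \<in> cube v s \<Longrightarrow> \<bar>u $ i - v $ i\<bar> \<le> s"
  by (simp add: cube_def)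

lemma cube_trans: "u \<in> cube v s \<Longrightarrow> w \<in> cube u t \<Longrightarrow> w \<in> cube v (s + t)"
  unfolding cube_def by (smt (verit) mem_Collect_eq)

lemma finite_cube: "finite (cube (v :: int ^ 'd::finite) s)"
proof -
  have "cube v s \<subseteq> (\<lambda>f. \<chi> i. f i) ` (PiE UNIV (\<lambda>i. {v $ i - s .. v $ i + s}))"
  proof
    fix u assume "u \<in> cube v s"
    then have "(\<lambda>i. u $ i) \<in> PiE UNIV (\<lambda>i. {v $ i - s .. v $ i + s})"
      by (auto simp: cube_def abs_le_iff algebra_simps)
    moreover have "u = (\<chi> i. u $ i)" by simp
    ultimately show "u \<in> (\<lambda>f. \<chi> i. f i) ` (PiE UNIV (\<lambda>i. {v $ i - s .. v $ i + s}))"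
      by blast
  qed
  moreover have "finite (PiE (UNIV :: 'd set) (\<lambda>i. {v $ i - s .. v $ i + s}))"
    by (intro finite_PiE) auto
  ultimately show ?thesis using finite_surj by blast
qed

lemma finite_subset_cube:
  assumes "finite F"
  shows "\<exists>s::nat. F \<subseteq> cube (v :: int ^ 'd::finite) (int s)"
proof
  define N where "N u = (\<Sum>i\<in>UNIV. nat \<bar>u $ i - v $ i\<bar>)" for u :: "int ^ 'd"
  show "F \<subseteq> cube v (int (\<Sum>u\<in>F. N u))"
  proof
    fix u assume u: "u \<in> F"
    show "u \<in> cube v (int (\<Sum>u\<in>F. N u))"
    proof (rule cubeI)
      fix i
      have "nat \<bar>u $ i - v $ i\<bar> \<le> N u"
        unfolding N_def by (rule member_le_sum) auto
      also have "\<dots> \<le> (\<Sum>u\<in>F. N u)"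
        by (rule member_le_sum[where f = N]) (use u assms in auto)
      finally show "\<bar>u $ i - v $ i\<bar> \<le> int (\<Sum>u\<in>F. N u)" by linarith
    qed
  qed
qed

lemma topspace_config: "topspace config_topology = UNIV"
  by (simp add: config_topology_def)

lemma compact_space_config: "compact_space (config_topology :: ('d::finite, 's::finite) config topology)"
  by (simp add: config_topology_def compact_space_product_topology compact_space_discrete_topology)

lemma openin_cylinder:
  fixes x :: "('d::finite, 's::finite) config"
  assumes "finite F"
  shows "openin config_topology {y. \<forall>v\<in>F. y v = x v}"
  unfolding config_topology_def openin_product_topology_alt
proof (intro ballI exI conjI)
  fix y assume y: "y \<in> {y. \<forall>v\<in>F. y v = x v}"
  let ?U = "\<lambda>v. if v \<in> F then {x v} else UNIV"
  show "finite {v \<in> UNIV. ?U v \<noteq> topspace (discrete_topology UNIV)}"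
    by (rule finite_subset[OF _ assms]) auto
  show "y \<in> PiE UNIV ?U" using y by auto
  show "PiE UNIV ?U \<subseteq> {y. \<forall>v\<in>F. y v = x v}"
  proof
    fix w assume "w \<in> PiE UNIV ?U"
    then have w: "w v \<in> ?U v" for v by blast
    have "w v = x v" if "v \<in> F" for v using w[of v] that by simp
    then show "w \<in> {y. \<forall>v\<in>F. y v = x v}" by blast
  qed
qed simp

text \<open>
  Compactness of the configuration space: if at every x some \<open>P t\<close> holds on a whole cylinder around x,
  then finitely many of these cylinders cover the space.
\<close>

lemma uniform_bound:
  fixes P :: "nat \<Rightarrow> ('d::finite, 's::finite) config \<Rightarrow> bool"
  assumes "\<And>x. \<exists>F t. finite F \<and> (\<forall>y. (\<forall>v\<in>F. y v = x v) \<longrightarrow> P t y)"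
  shows "\<exists>T. \<forall>x. \<exists>t\<le>T. P t x"
proof -
  obtain F t where F: "\<And>x. finite (F x)"
    and t: "\<And>x y. (\<forall>v\<in>F x. y v = x v) \<Longrightarrow> P (t x) y"
    using assms by metis
  define C where "C x = {y. \<forall>v\<in>F x. y v = x v}" for x
  have "\<forall>U\<in>range C. openin config_topology U"
    using F openin_cylinder unfolding C_def by blast
  moreover have "topspace config_topology \<subseteq> \<Union> (range C)"
    unfolding C_def by auto
  ultimately obtain \<F> where fin: "finite \<F>" and sub: "\<F> \<subseteq> range C"
    and cover: "topspace config_topology \<subseteq> \<Union> \<F>"
    using compact_space_config unfolding compact_space_alt by metis
  obtain X where X: "finite X" "\<F> = C ` X"
    using finite_subset_image[OF fin sub] by blast
  define T where "T = (\<Sum>x\<in>X. t x)"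
  show ?thesis
  proof (rule exI[of _ T], rule allI)
    fix y
    obtain x where x: "x \<in> X" "y \<in> C x"
      using cover X(2) unfolding topspace_config by blast
    have "P (t x) y" using t x(2) unfolding C_def by blast
    moreover have "t x \<le> T"
      unfolding T_def by (rule member_le_sum) (use x X in auto)
    ultimately show "\<exists>s\<le>T. P s y" by blast
  qed
qed

lemma shift_apply: "shift w x u = x (u + w)"
  by (simp add: shift_def)

text \<open>
  The Curtis--Hedlund--Lyndon theorem: continuity makes the new symbol at the origin depend on finitely
  many cells near each x, compactness bounds how far away they are, and shifts carry the bound
  to every cell.
\<close>

lemma cellular_automaton_radius:
  fixes c :: "('d::finite, 's::finite) config \<Rightarrow> ('d, 's) config"
  assumes "cellular_automaton c"
  shows "\<exists>r\<ge>0. \<forall>v x y. (\<forall>u\<in>cube v r. x u = y u) \<longrightarrow> c x v = c y v"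
proof -
  have cont: "continuous_map config_topology config_topology c"
    and comm: "\<And>v x. c (shift v x) = shift v (c x)"
    using assms unfolding cellular_automaton_def by (auto simp: fun_eq_iff)
  define P where "P t y \<longleftrightarrow> (\<forall>y'. (\<forall>u\<in>cube 0 (int t). y u = y' u) \<longrightarrow> c y 0 = c y' 0)" for t y
  have "\<exists>T. \<forall>x. \<exists>t\<le>T. P t x"
  proof (rule uniform_bound)
    fix x
    have "openin config_topology {y. \<forall>v\<in>{0}. y v = c x v}"
      by (rule openin_cylinder) simp
    then have "openin config_topology {y \<in> topspace config_topology. c y \<in> {y. \<forall>v\<in>{0}. y v = c x v}}"
      by (rule openin_continuous_map_preimage[OF cont])
    then have "openin (product_topology (\<lambda>_. discrete_topology UNIV) UNIV) {y. c y 0 = c x 0}"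
      by (simp add: topspace_config flip: config_topology_def)
    then obtain U where U: "finite {v. U v \<noteq> UNIV}" "x \<in> PiE UNIV U"
      "PiE UNIV U \<subseteq> {y. c y 0 = c x 0}"
      unfolding openin_product_topology_alt by auto
    \<comment> \<open>A basic open set constrains only finitely many cells; these are the ones that matter at x.\<close>
    let ?F = "{v. U v \<noteq> UNIV}"
    have key: "c y 0 = c x 0" if "\<forall>v\<in>?F. y v = x v" for y
    proof -
      have "y v \<in> U v" for v
        using that U(2) by (cases "U v = UNIV") auto
      then have "y \<in> PiE UNIV U" by auto
      then show ?thesis using U(3) by blast
    qed
    obtain t where t: "?F \<subseteq> cube 0 (int t)"
      using finite_subset_cube[OF U(1)] by blast
    have "P t y" if y: "\<forall>v\<in>?F. y v = x v" for y
      unfolding P_def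
    proof (intro allI impI)
      fix y' assume y': "\<forall>u\<in>cube 0 (int t). y u = y' u"
      have "c y' 0 = c x 0" by (rule key) (metis y y' t subsetD)
      then show "c y 0 = c y' 0" using key[OF y] by simp
    qed
    then show "\<exists>F t. finite F \<and> (\<forall>y. (\<forall>v\<in>F. y v = x v) \<longrightarrow> P t y)"
      using U(1) by blast
  qed
  then obtain T where T: "\<And>x. \<exists>t\<le>T. P t x" by blast
  have "c x v = c y v" if xy: "\<forall>u\<in>cube v (int T). x u = y u" for v x y
  proof -
    obtain t where t: "t \<le> T" "P t (shift v x)" using T by blast
    have "shift v x u = shift v y u" if "u \<in> cube 0 (int t)" for u
    proof -
      have "u + v \<in> cube v (int T)"
        by (rule cubeI) (use cubeD[OF that] t(1) in \<open>simp add: order_trans[of _ "int t"]\<close>)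
      then show ?thesis using xy by (simp add: shift_apply)
    qed
    then have "c (shift v x) 0 = c (shift v y) 0"
      using t(2) unfolding P_def by blast
    then show ?thesis by (simp add: comm shift_apply)
  qed
  then show ?thesis by (intro exI[of _ "int T"]) auto
qed

section \<open>Slabs and partially periodic configurations\<close>

text \<open>
  With the coordinates outside J taken modulo a period, a slab plays the part of a bounded box:
  \<open>slab UNIV s\<close> is a box around the origin and \<open>slab {} s\<close> is the whole lattice.
\<close>

definition slab :: "'d::finite set \<Rightarrow> int \<Rightarrow> (int ^ 'd) set" where
  "slab J s = {v. \<forall>j\<in>J. \<bar>v $ j\<bar> \<le> s}"

text \<open>
  The directions in J are the free ones. Stating periodicity in all other directions at once, by
  divisibility of the whole difference vector, avoids changing coordinates one at a time. No constraint
  is left when J is everything.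
\<close>

definition periodic_off :: "'d::finite set \<Rightarrow> int \<Rightarrow> ('d, 's) config \<Rightarrow> bool" where
  "periodic_off J p x \<longleftrightarrow>
     (\<forall>v w. (\<forall>j\<in>J. w $ j = v $ j) \<longrightarrow> (\<forall>i. p dvd w $ i - v $ i) \<longrightarrow> x w = x v)"

definition patch :: "(int ^ 'd) set \<Rightarrow> ('d, 's) config \<Rightarrow> ('d, 's) config \<Rightarrow> ('d, 's) config" where
  "patch H x y = (\<lambda>v. if v \<in> H then x v else y v)"

lemma slab_mono: "J' \<subseteq> J \<Longrightarrow> s \<le> t \<Longrightarrow> slab J s \<subseteq> slab J' t"
  unfolding slab_def by force

lemma cube_slab: "v \<in> slab J s \<Longrightarrow> u \<in> cube v t \<Longrightarrow> u \<in> slab J (s + t)"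
  unfolding slab_def cube_def by (smt (verit) mem_Collect_eq)

lemma periodic_offD:
  "periodic_off J p x \<Longrightarrow> (\<And>j. j \<in> J \<Longrightarrow> w $ j = v $ j) \<Longrightarrow> (\<And>i. p dvd w $ i - v $ i) \<Longrightarrow> x w = x v"
  unfolding periodic_off_def by blast

lemma periodic_off_const: "periodic_off J p (\<lambda>_. s)"
  by (simp add: periodic_off_def)

lemma periodic_off_shift:
  assumes "periodic_off J p x" shows "periodic_off J p (shift w x)"
  unfolding periodic_off_def shift_apply
  by (intro allI impI periodic_offD[OF assms]) auto

lemma periodic_off_patch:
  assumes "periodic_off J p x" "periodic_off J p y"
    and "\<And>v w. (\<And>j. j \<in> J \<Longrightarrow> w $ j = v $ j) \<Longrightarrow> v \<in> H \<Longrightarrow> w \<in> H"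
  shows "periodic_off J p (patch H x y)"
  unfolding periodic_off_def
proof (intro allI impI)
  fix v w assume vw: "\<forall>j\<in>J. w $ j = v $ j" "\<forall>i. p dvd w $ i - v $ i"
  have "w \<in> H \<longleftrightarrow> v \<in> H" using assms(3)[of v w] assms(3)[of w v] vw(1) by auto
  moreover have "x w = x v" "y w = y v" 
    using assms(1,2) vw unfolding periodic_off_def by blast+
  ultimately show "patch H x y w = patch H x y v" by (simp add: patch_def)
qed

lemma periodic_off_patch_slab:
  assumes "periodic_off J p x" "periodic_off J p y" "J' \<subseteq> J"
  shows "periodic_off J p (patch (slab J' K) x y)"
  by (rule periodic_off_patch[OF assms(1,2)]) (use assms(3) in \<open>force simp: slab_def\<close>)

text \<open>
  A slab is finite modulo the periods, so pointwise statements about periodic configurations become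
  uniform on it.
\<close>

lemma slab_representative:
  assumes "1 \<le> p" "v \<in> slab J s"
  obtains v' where "v' \<in> cube 0 (max s p)" "v' \<in> slab J s"
    "\<And>x :: ('d::finite, 's) config. periodic_off J p x \<Longrightarrow> x v = x v'"
proof
  define v' where "v' = (\<chi> i. if i \<in> J then v $ i else v $ i mod p)"
  show "v' \<in> cube 0 (max s p)"
  proof (rule cubeI)
    fix i
    have "0 \<le> v $ i mod p" "v $ i mod p < p" using assms(1) by auto
    then show "\<bar>v' $ i - 0 $ i\<bar> \<le> max s p"
      using assms(2) unfolding v'_def slab_def by auto
  qed
  show "v' \<in> slab J s" using assms(2) by (simp add: v'_def slab_def)
  show "x v = x v'" if "periodic_off J p x" for x :: "('d, 's) config"
    by (rule periodic_offD[OF that]) (auto simp: v'_def minus_mod_eq_mult_div)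
qed

section \<open>Finite speed of propagation and eventual quiet\<close>

locale asymptotic_automaton =
  fixes c :: "('d::finite, 's::finite) config \<Rightarrow> ('d, 's) config" and z :: 's and r :: int
  assumes radius_nonneg: "0 \<le> r"
    and local_rule: "(\<And>u. u \<in> cube v r \<Longrightarrow> x u = y u) \<Longrightarrow> c x v = c y v"
    and shift_c: "c (shift w x) = shift w (c x)"
    and asymptotic: "\<exists>m. \<forall>n\<ge>m. (c ^^ n) x v = z"
begin

abbreviation blank :: "('d, 's) config" where "blank \<equiv> \<lambda>_. z"

definition vanishes :: "(int ^ 'd) set \<Rightarrow> ('d, 's) config \<Rightarrow> bool" where
  "vanishes A x \<longleftrightarrow> (\<forall>v\<in>A. x v = z)"

definition mortal :: "('d, 's) config \<Rightarrow> bool" where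
  "mortal x \<longleftrightarrow> (\<exists>T. (c ^^ T) x = blank)"

definition bounded_in :: "'d set \<Rightarrow> ('d, 's) config \<Rightarrow> bool" where
  "bounded_in J x \<longleftrightarrow> (\<exists>L. vanishes (- slab J L) x)"

lemma vanishesD: "vanishes A x \<Longrightarrow> v \<in> A \<Longrightarrow> x v = z"
  by (simp add: vanishes_def)

lemma vanishes_mono: "vanishes A x \<Longrightarrow> B \<subseteq> A \<Longrightarrow> vanishes B x"
  unfolding vanishes_def by blast

lemma funpow_c_add: "(c ^^ (m + n)) x = (c ^^ m) ((c ^^ n) x)"
  by (simp add: funpow_add)

lemma funpow_local:
  "(\<And>u. u \<in> cube v (int n * r) \<Longrightarrow> x u = y u) \<Longrightarrow> (c ^^ n) x v = (c ^^ n) y v"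
proof (induction n arbitrary: v)
  case 0
  have "v \<in> cube v (int 0 * r)" by (simp add: cube_def)
  then have "x v = y v" by (rule 0)
  then show ?case by simp
next
  case (Suc n)
  have "(c ^^ n) x u = (c ^^ n) y u" if "u \<in> cube v r" for u
  proof (rule Suc.IH)
    fix w assume "w \<in> cube u (int n * r)"
    with that have "w \<in> cube v (r + int n * r)" by (rule cube_trans)
    then have "w \<in> cube v (int (Suc n) * r)" by (simp add: algebra_simps)
    then show "x w = y w" by (rule Suc.prems)
  qed
  then have "c ((c ^^ n) x) v = c ((c ^^ n) y) v"
    by (rule local_rule[of v "(c ^^ n) x" "(c ^^ n) y"])
  then show ?case by simp
qed

lemma funpow_shift: "(c ^^ n) (shift w x) = shift w ((c ^^ n) x)"
  by (induction n) (simp_all add: shift_c)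

lemma periodic_off_c:
  assumes "periodic_off J p x" shows "periodic_off J p ((c ^^ n) x)"
  unfolding periodic_off_def
proof (intro allI impI)
  fix v w assume vw: "\<forall>j\<in>J. w $ j = v $ j" "\<forall>i. p dvd w $ i - v $ i"
  have "shift (w - v) x = x"
    unfolding shift_def by (intro ext periodic_offD[OF assms]) (use vw in auto)
  then have "(c ^^ n) x v = (c ^^ n) (shift (w - v) x) v" by simp
  also have "\<dots> = (c ^^ n) x w" by (simp add: funpow_shift shift_apply)
  finally show "(c ^^ n) x w = (c ^^ n) x v" by simp
qed

text \<open>
  All iterates of the zero configuration are constant, and from some time on they are zero, so zero is
  the image of zero.
\<close>

lemma c_blank: "c blank = blank"
proof -
  have const: "(c ^^ n) blank v = (c ^^ n) blank 0" for n v
  proof -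
    have "shift v blank = blank" by (simp add: shift_def)
    then have "(c ^^ n) blank 0 = (c ^^ n) (shift v blank) 0" by simp
    then show ?thesis by (simp add: funpow_shift shift_apply)
  qed
  obtain m where m: "\<And>n. n \<ge> m \<Longrightarrow> (c ^^ n) blank 0 = z"
    using asymptotic by blast
  have dead: "(c ^^ n) blank = blank" if "n \<ge> m" for n
  proof
    fix v show "(c ^^ n) blank v = z" using const[where n = n and v = v] m[OF that] by (rule trans)
  qed
  have "c blank = c ((c ^^ m) blank)" by (rule arg_cong[OF dead[OF order_refl, symmetric]])
  also have "\<dots> = (c ^^ Suc m) blank" by simp
  also have "\<dots> = blank" by (rule dead) simp
  finally show ?thesis .
qed

lemma funpow_blank: "(c ^^ n) blank = blank"
  by (induction n) (simp_all add: c_blank)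

lemma funpow_vanish:
  assumes "\<And>u. u \<in> cube v (int n * r) \<Longrightarrow> x u = z"
  shows "(c ^^ n) x v = z"
  using funpow_local[of v n x blank] assms by (simp add: funpow_blank)

lemma vanishes_funpow_outside:
  assumes "vanishes (- slab J L) x" shows "vanishes (- slab J (L + int n * r)) ((c ^^ n) x)"
  unfolding vanishes_def
proof (intro ballI funpow_vanish)
  fix v u assume v: "v \<in> - slab J (L + int n * r)" and u: "u \<in> cube v (int n * r)"
  have "v \<in> cube u (int n * r)" using u by (simp add: cube_def abs_minus_commute)
  then have "u \<notin> slab J L" using v cube_slab by blast
  then show "x u = z" using assms by (simp add: vanishes_def)
qed

lemma vanishes_funpow_inside:
  assumes "vanishes (slab J R) x" "s + int n * r \<le> R"
  shows "vanishes (slab J s) ((c ^^ n) x)"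
  unfolding vanishes_def
proof (intro ballI funpow_vanish)
  fix v u assume v: "v \<in> slab J s" and u: "u \<in> cube v (int n * r)"
  have "u \<in> slab J R" using cube_slab[OF v u] slab_mono[OF order_refl assms(2)] by blast
  then show "x u = z" using assms(1) by (simp add: vanishes_def)
qed

lemma dead_stays_dead:
  assumes "(c ^^ T) x = blank" "T \<le> n" shows "(c ^^ n) x = blank"
proof -
  have "(c ^^ n) x = (c ^^ (n - T)) ((c ^^ T) x)"
    using assms(2) by (simp flip: funpow_c_add)
  then show ?thesis by (simp add: assms(1) funpow_blank)
qed

lemma mortal_funpow: "mortal ((c ^^ n) x) \<longleftrightarrow> mortal x"
proof
  assume "mortal ((c ^^ n) x)"
  then show "mortal x" unfolding mortal_def by (metis funpow_c_add)
next
  assume "mortal x"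
  then obtain T where "(c ^^ T) x = blank" unfolding mortal_def by blast
  then have "(c ^^ T) ((c ^^ n) x) = blank"
    using dead_stays_dead[of T x "T + n"] by (simp add: funpow_c_add)
  then show "mortal ((c ^^ n) x)" unfolding mortal_def by blast
qed

text \<open>
  Each cell of a finite set of representatives is eventually zero; the sum of the finitely many
  times bounds them all.
\<close>

lemma eventually_vanishes_slab:
  assumes "periodic_off J p x" "1 \<le> p"
  shows "\<exists>T. \<forall>n\<ge>T. vanishes (slab J s) ((c ^^ n) x)"
proof -
  let ?F = "cube (0 :: int ^ 'd) (max s p)"
  obtain m where m: "\<And>v n. m v \<le> n \<Longrightarrow> (c ^^ n) x v = z"
    using asymptotic by metis
  show ?thesis
  proof (intro exI[of _ "\<Sum>v\<in>?F. m v"] allI impI)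
    fix n assume n: "(\<Sum>v\<in>?F. m v) \<le> n"
    show "vanishes (slab J s) ((c ^^ n) x)"
      unfolding vanishes_def
    proof
      fix v assume v: "v \<in> slab J s"
      obtain v' where v': "v' \<in> ?F"
        and same: "\<And>y :: ('d, 's) config. periodic_off J p y \<Longrightarrow> y v = y v'"
        using slab_representative[OF assms(2) v] by metis
      from v' have "m v' \<le> (\<Sum>v\<in>?F. m v)"
        by (intro member_le_sum) (auto simp: finite_cube)
      then have "(c ^^ n) x v' = z" using m n by (meson order_trans)
      moreover have "(c ^^ n) x v = (c ^^ n) x v'"
        by (rule same[OF periodic_off_c[OF assms(1)]])
      ultimately show "(c ^^ n) x v = z" by simp
    qed
  qed
qed

text \<open>
  Asymptotic nilpotency alone kills an orbit that stays in a slab: the slab is eventually empty, and there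
  is nothing outside it.
\<close>

lemma confined_mortal:
  assumes "periodic_off J p x" "1 \<le> p" "\<And>n. vanishes (- slab J L) ((c ^^ n) x)"
  shows "mortal x"
proof -
  obtain T where "vanishes (slab J L) ((c ^^ T) x)"
    using eventually_vanishes_slab[OF assms(1,2)] by blast
  with assms(3)[of T] have "(c ^^ T) x = blank"
    unfolding vanishes_def by blast
  then show ?thesis unfolding mortal_def by blast
qed

section \<open>Category and compactness arguments\<close>

text \<open>
  A Baire category argument inside an arbitrary set G. If every element of G could be changed, within G
  and arbitrarily far away, so as to disturb the central slab at a later time, then successive changes
  would converge to a configuration that disturbs the slab infinitely often. The limit need not lie
  in G; only its periodicity matters. The point of the freedom in G is that it can be the set of
  all periodic configurations or a much smaller set, such as that of bounded mortal ones.
\<close>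

lemma baire_quiet_pattern:
  assumes "x \<in> G" and periodic: "\<And>y. y \<in> G \<Longrightarrow> periodic_off J p y" and p: "1 \<le> p"
  shows "\<exists>y\<in>G. \<exists>K\<ge>0. \<exists>m. \<forall>y'\<in>G. (\<forall>v\<in>slab J K. y' v = y v) \<longrightarrow>
           (\<forall>n\<ge>m. vanishes (slab J s) ((c ^^ n) y'))"
proof (rule ccontr)
  assume neg: "\<not> ?thesis"
  have step: "\<exists>y'\<in>G. (\<forall>v\<in>slab J K. y' v = y v) \<and>
      (\<exists>n\<ge>m. \<not> vanishes (slab J s) ((c ^^ n) y'))" if "y \<in> G" "0 \<le> K" for y K m
    using neg that by blast
  \<comment> \<open>A state is a configuration together with the radius of the slab on which it will not change any more; that radius must contain everything that caused the last disturbance.\<close>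
  define Q where "Q k a b \<longleftrightarrow> (\<forall>v\<in>slab J (snd a). fst b v = fst a v) \<and> snd a < snd b \<and>
     (\<exists>n\<ge>k. \<not> vanishes (slab J s) ((c ^^ n) (fst b)) \<and> s + int n * r \<le> snd b)"
    for k :: nat and a b :: "('d, 's) config \<times> int"
  have "\<exists>f. \<forall>k. (fst (f k) \<in> G \<and> int k \<le> snd (f k)) \<and> Q k (f k) (f (Suc k))"
  proof (rule dependent_nat_choice)
    show "\<exists>a. fst a \<in> G \<and> int 0 \<le> snd a" using assms(1) by (intro exI[of _ "(x, 0)"]) simp
  next
    fix a :: "('d, 's) config \<times> int" and k assume a: "fst a \<in> G \<and> int k \<le> snd a"
    obtain y' n where y': "y' \<in> G" "\<forall>v\<in>slab J (snd a). y' v = fst a v" "n \<ge> k"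
      "\<not> vanishes (slab J s) ((c ^^ n) y')"
      using step[of "fst a" "snd a" k] a by force
    let ?b = "(y', max (snd a + 1) (s + int n * r))"
    have "(fst ?b \<in> G \<and> int (Suc k) \<le> snd ?b) \<and> Q k a ?b"
      unfolding Q_def using y' a by auto
    then show "\<exists>b. (fst b \<in> G \<and> int (Suc k) \<le> snd b) \<and> Q k a b" by blast
  qed
  then obtain f where f: "\<And>k. fst (f k) \<in> G" "\<And>k. int k \<le> snd (f k)"
    "\<And>k. Q k (f k) (f (Suc k))" by blast
  have K_mono: "snd (f k) \<le> snd (f l)" if "k \<le> l" for k l
    using that
  proof (induction rule: dec_induct)
    case (step l)
    have "snd (f l) < snd (f (Suc l))" using f(3)[of l] by (simp add: Q_def)
    with step.IH show ?case by linarith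
  qed simp
  have agree: "fst (f l) v = fst (f k) v" if "k \<le> l" "v \<in> slab J (snd (f k))" for k l v
    using that
  proof (induction rule: dec_induct)
    case (step l)
    have "v \<in> slab J (snd (f l))"
      using step.prems slab_mono[OF order_refl K_mono[OF step.hyps(1)]] by blast
    then show ?case using f(3)[of l] step unfolding Q_def by simp
  qed simp
  \<comment> \<open>The cell v has its final value from step \<open>N v\<close> on, as the radii grow at least by one in each step.\<close>
  define N where "N v = (\<Sum>i\<in>UNIV. nat \<bar>v $ i\<bar>)" for v :: "int ^ 'd"
  have inN: "v \<in> slab J (snd (f (N v)))" for v
    unfolding slab_def
  proof (intro CollectI ballI)
    fix j
    have "nat \<bar>v $ j\<bar> \<le> N v" unfolding N_def by (rule member_le_sum) auto
    then show "\<bar>v $ j\<bar> \<le> snd (f (N v))" using f(2)[of "N v"] by linarith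
  qed
  define Y where "Y v = fst (f (N v)) v" for v
  have Y: "Y v = fst (f k) v" if "v \<in> slab J (snd (f k))" for v k
    using agree[of "N v" "max (N v) k" v] agree[of k "max (N v) k" v] inN[of v] that
    unfolding Y_def by simp
  have "periodic_off J p Y"
    unfolding periodic_off_def
  proof (intro allI impI)
    fix v w assume vw: "\<forall>j\<in>J. w $ j = v $ j" "\<forall>i. p dvd w $ i - v $ i"
    have w: "w \<in> slab J (snd (f (N v)))" using inN[of v] vw(1) by (auto simp: slab_def)
    have "Y w = fst (f (N v)) w" using Y[OF w] .
    also have "\<dots> = fst (f (N v)) v"
      using periodic[OF f(1)] vw unfolding periodic_off_def by blast
    finally show "Y w = Y v" by (simp add: Y_def)
  qed
  then obtain T where T: "\<And>n. n \<ge> T \<Longrightarrow> vanishes (slab J s) ((c ^^ n) Y)"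
    using eventually_vanishes_slab p by blast
  obtain n where n: "n \<ge> T" "\<not> vanishes (slab J s) ((c ^^ n) (fst (f (Suc T))))"
    "s + int n * r \<le> snd (f (Suc T))"
    using f(3)[of T] unfolding Q_def by blast
  have "(c ^^ n) Y v = (c ^^ n) (fst (f (Suc T))) v" if "v \<in> slab J s" for v
  proof (rule funpow_local)
    fix u assume "u \<in> cube v (int n * r)"
    then have "u \<in> slab J (snd (f (Suc T)))"
      using cube_slab[OF that] slab_mono[OF order_refl n(3)] by blast
    then show "Y u = fst (f (Suc T)) u" by (rule Y)
  qed
  with T[OF n(1)] n(2) show False unfolding vanishes_def by simp
qed

text \<open>
  Every configuration vanishes on the slab of radius R at some time, and by compactness these times are
  bounded. From its time on, the hypothesis keeps the origin zero, and shifting gives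
  every cell.
\<close>

lemma uniformly_mortal:
  assumes p: "1 \<le> p"
    and block: "\<And>x n. periodic_off J p x \<Longrightarrow> vanishes (slab J R) x \<Longrightarrow> (c ^^ n) x 0 = z"
  shows "\<exists>T. \<forall>x. periodic_off J p x \<longrightarrow> (c ^^ T) x = blank"
proof -
  define P where "P t x \<longleftrightarrow> (periodic_off J p x \<longrightarrow> vanishes (slab J R) ((c ^^ t) x))" for t x
  have "\<exists>T. \<forall>x. \<exists>t\<le>T. P t x"
  proof (rule uniform_bound)
    fix x
    show "\<exists>F t. finite F \<and> (\<forall>y. (\<forall>v\<in>F. y v = x v) \<longrightarrow> P t y)"
    proof (cases "periodic_off J p x")
      case False
      then obtain v w where vw: "\<forall>j\<in>J. w $ j = v $ j" "\<forall>i. p dvd w $ i - v $ i" "x w \<noteq> x v"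
        unfolding periodic_off_def by blast
      have "P t y" if "\<forall>u\<in>{v, w}. y u = x u" for t y
        unfolding P_def periodic_off_def using vw that by (metis insertCI)
      then show ?thesis by (meson finite.emptyI finite.insertI)
    next
      case True
      then obtain t where t: "vanishes (slab J R) ((c ^^ t) x)"
        using eventually_vanishes_slab[OF True p] by blast
      let ?F = "cube (0 :: int ^ 'd) (max R p + int t * r)"
      have "P t y" if y: "\<forall>u\<in>?F. y u = x u" for y
        unfolding P_def vanishes_def
      proof (intro impI ballI)
        fix v assume per: "periodic_off J p y" and v: "v \<in> slab J R"
        obtain v' where v': "v' \<in> cube 0 (max R p)" "v' \<in> slab J R"
          and same: "\<And>w :: ('d, 's) config. periodic_off J p w \<Longrightarrow> w v = w v'"
          using slab_representative[OF p v] by metis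
        have "(c ^^ t) y v = (c ^^ t) y v'"
          by (rule same[OF periodic_off_c[OF per]])
        also have "\<dots> = (c ^^ t) x v'"
          by (rule funpow_local) (use y cube_trans[OF v'(1)] in blast)
        also have "\<dots> = z" using t v'(2) by (rule vanishesD)
        finally show "(c ^^ t) y v = z" .
      qed
      then show ?thesis using finite_cube by blast
    qed
  qed
  then obtain T where T: "\<And>x. \<exists>t\<le>T. P t x" by blast
  have "(c ^^ T) x v = z" if x: "periodic_off J p x" for x v
  proof -
    let ?x = "shift v x"
    have per: "periodic_off J p ?x" using x by (rule periodic_off_shift)
    obtain t where t: "t \<le> T" "vanishes (slab J R) ((c ^^ t) ?x)"
      using T[of ?x] per unfolding P_def by blast
    have "(c ^^ (T - t)) ((c ^^ t) ?x) 0 = z"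
      using block[OF periodic_off_c[OF per] t(2)] .
    then have "(c ^^ T) ?x 0 = z" using t(1) by (simp flip: funpow_c_add)
    then show ?thesis by (simp add: funpow_shift shift_apply)
  qed
  then show ?thesis by blast
qed

section \<open>Quiet patterns as shields\<close>

text \<open>
  If x lives near the origin and dies at time T without having met y, then planting x leaves no trace
  at time T. The margin is twice the distance travelled: once for x going out and once
  for y coming in.
\<close>

lemma superposition:
  assumes x: "vanishes (- slab J K) x" "(c ^^ T) x = blank"
    and y: "vanishes (slab J (K + 2 * (int T * r))) y"
  shows "(c ^^ T) (patch (slab J K) x y) = (c ^^ T) y"
proof
  fix v
  show "(c ^^ T) (patch (slab J K) x y) v = (c ^^ T) y v"
  proof (cases "v \<in> slab J (K + int T * r)")
    case True
    have near: "u \<in> slab J (K + 2 * (int T * r))" if "u \<in> cube v (int T * r)" for u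
      using cube_slab[OF True that] by (simp add: algebra_simps)
    have "(c ^^ T) (patch (slab J K) x y) v = (c ^^ T) x v"
      by (rule funpow_local) (use near x(1) y in \<open>auto simp: patch_def vanishes_def\<close>)
    also have "\<dots> = (c ^^ T) y v"
      using funpow_vanish[of v T y] near y x(2) by (auto simp: vanishes_def)
    finally show ?thesis .
  next
    case False
    have far: "u \<notin> slab J K" if "u \<in> cube v (int T * r)" for u
    proof
      assume "u \<in> slab J K"
      moreover have "v \<in> cube u (int T * r)" using that by (simp add: cube_def abs_minus_commute)
      ultimately show False using False cube_slab by blast
    qed
    show ?thesis
      by (rule funpow_local) (use far in \<open>auto simp: patch_def\<close>)
  qed
qed

text \<open>
  If planting x in the empty centre of g forces quiet from time m on, then g by itself is quiet too:
  after x has died the two orbits coincide, and before that nothing from g has had time to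
  arrive.
\<close>

lemma shield:
  assumes "J' \<subseteq> J" and x: "vanishes (- slab J' K) x" "(c ^^ T) x = blank"
    and quiet: "\<And>n. m \<le> n \<Longrightarrow> vanishes (slab J s) ((c ^^ n) (patch (slab J' K) x g))"
    and g: "vanishes (slab J' M) g" "K + 2 * (int T * r) \<le> M" "s + int (T + m) * r \<le> M"
  shows "vanishes (slab J s) ((c ^^ t) g)"
proof (cases "t \<le> T + m")
  case True
  then have "int t * r \<le> int (T + m) * r" 
    using radius_nonneg by (intro mult_right_mono) auto
  then have "s + int t * r \<le> M" using g(3) by linarith
  moreover have "vanishes (slab J M) g"
    using vanishes_mono[OF g(1) slab_mono[OF assms(1) order_refl]] .
  ultimately show ?thesis by (intro vanishes_funpow_inside)
next
  case False
  define k where "k = t - T"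
  have k: "t = k + T" "m \<le> k" using False by (auto simp: k_def)
  have "vanishes (slab J' (K + 2 * (int T * r))) g"
    using vanishes_mono[OF g(1) slab_mono[OF order_refl g(2)]] .
  then have "(c ^^ t) g = (c ^^ t) (patch (slab J' K) x g)"
    using superposition[OF x] by (simp add: k(1) funpow_c_add)
  then show ?thesis using quiet k by simp
qed

text \<open>
  The pattern that x0 shows on the slab of radius K forces quiet on the slab of radius s from time m on,
  no matter what surrounds it.
\<close>

definition quiet_after :: "'d set \<Rightarrow> int \<Rightarrow> int \<Rightarrow> ('d, 's) config \<Rightarrow> int \<Rightarrow> nat \<Rightarrow> bool" where
  "quiet_after J p s x0 K m \<longleftrightarrow>
     (\<forall>x. periodic_off J p x \<longrightarrow> (\<forall>v\<in>slab J K. x v = x0 v) \<longrightarrow>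
        (\<forall>n\<ge>m. vanishes (slab J s) ((c ^^ n) x)))"

lemma quiet_afterD:
  "quiet_after J p s x0 K m \<Longrightarrow> periodic_off J p x \<Longrightarrow> (\<And>v. v \<in> slab J K \<Longrightarrow> x v = x0 v) \<Longrightarrow>
   m \<le> n \<Longrightarrow> v \<in> slab J s \<Longrightarrow> (c ^^ n) x v = z"
  unfolding quiet_after_def vanishes_def by blast

lemma quiet_after_translate:
  assumes "quiet_after J p s x0 K m" "periodic_off J p x"
    and "\<And>v. v \<in> slab J K \<Longrightarrow> x (v + w) = x0 v" "m \<le> n" "v - w \<in> slab J s"
  shows "(c ^^ n) x v = z"
proof -
  have "(c ^^ n) (shift w x) (v - w) = z"
    by (rule quiet_afterD[OF assms(1) periodic_off_shift[OF assms(2)] _ assms(4,5)])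
      (simp add: shift_apply assms(3))
  then show ?thesis by (simp add: funpow_shift shift_apply)
qed

lemma quiet_pattern_exists:
  assumes "1 \<le> p"
  shows "\<exists>x0 K m. 0 \<le> K \<and> periodic_off J p x0 \<and> quiet_after J p s x0 K m"
proof -
  have "blank \<in> {x. periodic_off J p x}" by (simp add: periodic_off_const)
  from baire_quiet_pattern[OF this _ assms, of J s] show ?thesis
    unfolding quiet_after_def by auto
qed

text \<open>
  The slab \<open>slab J' M\<close> is unbounded in the directions \<open>J - J'\<close>. So a quiet pattern repeated along
  these directions shields a whole tube, provided that the repeated pattern dies.
\<close>

lemma block:
  assumes quiet: "quiet_after J p s x0 K m" and "J' \<subseteq> J"
    and x: "periodic_off J p x" "\<And>v. v \<in> slab J K \<Longrightarrow> x v = x0 v" "vanishes (- slab J' K) x" "mortal x"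
  shows "\<exists>M. \<forall>g. periodic_off J p g \<longrightarrow> vanishes (slab J' M) g \<longrightarrow> (\<forall>t. vanishes (slab J s) ((c ^^ t) g))"
proof -
  obtain T where T: "(c ^^ T) x = blank" using x(4) unfolding mortal_def by blast
  define M where "M = max (K + 2 * (int T * r)) (s + int (T + m) * r)"
  have "vanishes (slab J s) ((c ^^ t) g)" if g: "periodic_off J p g" "vanishes (slab J' M) g" for g t
  proof (rule shield[OF \<open>J' \<subseteq> J\<close> x(3) T _ g(2)])
    have "periodic_off J p (patch (slab J' K) x g)"
      by (rule periodic_off_patch_slab[OF x(1) g(1) \<open>J' \<subseteq> J\<close>])
    moreover have "patch (slab J' K) x g v = x0 v" if "v \<in> slab J K" for v
      using that slab_mono[OF \<open>J' \<subseteq> J\<close> order_refl, of K] x(2) by (auto simp: patch_def)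
    ultimately show "vanishes (slab J s) ((c ^^ n) (patch (slab J' K) x g))" if "m \<le> n" for n
      using quiet that unfolding quiet_after_def by blast
  qed (auto simp: M_def)
  then show ?thesis by blast
qed

text \<open>
  Once the quiet pattern on its own is mortal, no configuration that is zero near the origin can ever reach
  the origin, and \<open>uniformly_mortal\<close> applies.
\<close>

lemma nilpotent_if_mortal_pattern:
  assumes p: "1 \<le> p" and s: "0 \<le> s" and quiet: "quiet_after J p s x0 K m" and x0: "periodic_off J p x0"
    and mortal: "mortal (patch (slab J K) x0 blank)"
  shows "\<exists>T. \<forall>x. periodic_off J p x \<longrightarrow> (c ^^ T) x = blank"
proof -
  let ?x = "patch (slab J K) x0 blank"
  have "periodic_off J p ?x"
    by (rule periodic_off_patch_slab[OF x0 periodic_off_const order_refl])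
  moreover have "vanishes (- slab J K) ?x" by (simp add: vanishes_def patch_def)
  moreover have "?x v = x0 v" if "v \<in> slab J K" for v using that by (simp add: patch_def)
  ultimately obtain M where M: "\<And>g t. periodic_off J p g \<Longrightarrow> vanishes (slab J M) g \<Longrightarrow>
      vanishes (slab J s) ((c ^^ t) g)"
    using block[OF quiet order_refl _ _ _ mortal] by blast
  have "0 \<in> slab J s" using s by (simp add: slab_def)
  then show ?thesis
    using M by (intro uniformly_mortal[OF p, of J M]) (auto dest: vanishesD)
qed

text \<open>
  The category argument among bounded mortal configurations. It gives a mortal y whose surroundings,
  as long as they are mortal too, never disturb the centre late. A mortal g far away could
  be added to y without leaving this class, and y disappears before g arrives.
\<close>

lemma mortal_debris_misses:
  assumes p: "1 \<le> p"
  shows "\<exists>R\<ge>0. \<forall>g. periodic_off J p g \<longrightarrow> bounded_in J g \<longrightarrow> mortal g \<longrightarrow> vanishes (slab J R) g \<longrightarrow>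
           (\<forall>t. vanishes (slab J s) ((c ^^ t) g))"
proof -
  define G where "G = {g. periodic_off J p g \<and> bounded_in J g \<and> mortal g}"
  have "mortal blank" unfolding mortal_def by (intro exI[of _ 0]) simp
  then have "blank \<in> G" by (simp add: G_def periodic_off_const bounded_in_def vanishes_def)
  from baire_quiet_pattern[OF this _ p, of J s] obtain y K m where y: "y \<in> G" and
    quiet: "\<And>y' n. y' \<in> G \<Longrightarrow> (\<And>v. v \<in> slab J K \<Longrightarrow> y' v = y v) \<Longrightarrow> n \<ge> m \<Longrightarrow>
      vanishes (slab J s) ((c ^^ n) y')"
    unfolding G_def by blast
  obtain L where L: "vanishes (- slab J L) y" using y unfolding G_def bounded_in_def by blast
  obtain T where T: "(c ^^ T) y = blank" using y unfolding G_def mortal_def by blast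
  define N where "N = max K L"
  have N: "vanishes (- slab J N) y"
    using vanishes_mono[OF L] slab_mono[OF order_refl, of L N J] by (auto simp: N_def)
  define R where "R = max 0 (max (N + 2 * (int T * r)) (s + int (T + m) * r))"
  have "vanishes (slab J s) ((c ^^ t) g)" if g: "g \<in> G" "vanishes (slab J R) g" for g t
  proof (rule shield[OF order_refl N T _ g(2)])
    let ?h = "patch (slab J N) y g"
    have "periodic_off J p ?h"
      by (rule periodic_off_patch_slab) (use y g(1) in \<open>auto simp: G_def\<close>)
    moreover have "bounded_in J ?h"
    proof -
      obtain L' where "vanishes (- slab J L') g" using g(1) unfolding G_def bounded_in_def by blast
      then have "vanishes (- slab J (max N L')) ?h"
        using slab_mono[OF order_refl, of N "max N L'" J] slab_mono[OF order_refl, of L' "max N L'" J]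
        by (auto simp: vanishes_def patch_def)
      then show ?thesis unfolding bounded_in_def by blast
    qed
    moreover have "mortal ?h"
    proof -
      have "(c ^^ T) ?h = (c ^^ T) g"
        by (rule superposition[OF N T vanishes_mono[OF g(2) slab_mono]]) (auto simp: R_def)
      then show ?thesis using g(1) mortal_funpow[of T] unfolding G_def by (metis mem_Collect_eq)
    qed
    ultimately have "?h \<in> G" by (simp add: G_def)
    moreover have "?h v = y v" if "v \<in> slab J K" for v
      using that slab_mono[OF order_refl, of K N J] by (auto simp: patch_def N_def)
    ultimately show "vanishes (slab J s) ((c ^^ n) ?h)" if "m \<le> n" for n
      using quiet that by blast
  qed (auto simp: R_def)
  then show ?thesis
    by (intro exI[of _ R]) (auto simp: R_def G_def)
qed

section \<open>One free direction: trapped debris\<close>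

text \<open>
  If the cells on both sides of the boundary of H are zero at all times, nothing crosses the boundary, so the
  part inside H evolves as if the outside were empty.
\<close>

lemma cut_orbit:
  assumes "\<And>n v u. v \<in> H \<Longrightarrow> u \<notin> H \<Longrightarrow> u \<in> cube v r \<Longrightarrow> (c ^^ n) x v = z \<and> (c ^^ n) x u = z"
  shows "(c ^^ n) (patch H x blank) = patch H ((c ^^ n) x) blank"
proof (induction n)
  case (Suc n)
  let ?y = "(c ^^ n) x"
  have "c (patch H ?y blank) v = patch H (c ?y) blank v" for v
  proof (cases "v \<in> H")
    case True
    have "c (patch H ?y blank) v = c ?y v"
      by (rule local_rule) (use assms True in \<open>auto simp: patch_def\<close>)
    then show ?thesis using True by (simp add: patch_def)
  next
    case False
    have "c (patch H ?y blank) v = c blank v"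
    proof (rule local_rule)
      fix u assume "u \<in> cube v r"
      then have "v \<in> cube u r" by (simp add: cube_def abs_minus_commute)
      then show "patch H ?y blank u = blank u"
        using assms[of u v n] False by (simp add: patch_def)
    qed
    then show ?thesis using False by (simp add: patch_def c_blank)
  qed
  then have "c (patch H ?y blank) = patch H (c ?y) blank" by (rule ext)
  then show ?case by (simp add: Suc.IH)
qed simp

text \<open>
  In a single direction the quiet pattern is a wall, as its quiet zone extends r cells to either side.
  Let a be what is left of a lone pattern at time m. If it never disturbs the zones around
  D and -D, it is confined between them and dies.
  
  To see that it does not disturb the zone at D, plant one copy of the pattern at -D and another at a
  distant D'. What lies between the two at time m is trapped between two walls, so it is mortal. It is also
  zero near the origin, and so it never disturbs the origin. Up to any given time t the second copy,
  being far enough away, has no influence near the origin, where the trapped part therefore coincides with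
  the translated orbit of a. The sign \<open>\<epsilon>\<close> covers the mirror image.
\<close>

lemma pattern_mortal_one_direction:
  assumes p: "1 \<le> p" and K: "0 \<le> K" and x0: "periodic_off {j} p x0"
    and quiet: "quiet_after {j} p r x0 K m"
  shows "mortal (patch (slab {j} K) x0 blank)"
proof -
  define x where "x = patch (slab {j} K) x0 blank"
  define a where "a = (c ^^ m) x"
  have x: "periodic_off {j} p x"
    unfolding x_def by (rule periodic_off_patch_slab[OF x0 periodic_off_const order_refl])
  have a: "periodic_off {j} p a" unfolding a_def using x by (rule periodic_off_c)
  have "vanishes (- slab {j} K) x" by (simp add: vanishes_def x_def patch_def)
  then have a_outside: "vanishes (- slab {j} (K + int m * r)) a"
    unfolding a_def by (rule vanishes_funpow_outside)
  obtain R where R: "0 \<le> R" and misses: "\<And>g t. periodic_off {j} p g \<Longrightarrow> bounded_in {j} g \<Longrightarrow>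
      mortal g \<Longrightarrow> vanishes (slab {j} R) g \<Longrightarrow> vanishes (slab {j} r) ((c ^^ t) g)"
    using mortal_debris_misses[OF p, of "{j}" r] by blast
  define D where "D = R + K + int m * r + r + 1"
  have mr: "0 \<le> int m * r" using radius_nonneg by simp
  have strip: "(c ^^ t) a v = z" if \<epsilon>: "\<epsilon> = 1 \<or> \<epsilon> = -1" and v: "\<bar>\<epsilon> * v $ j - D\<bar> \<le> r" for \<epsilon> t v
  proof -
    \<comment> \<open>The first copy alone determines the cells up to E at time 0, hence those up to \<open>D + r\<close> until time \<open>t + m\<close>.\<close>
    define E where "E = D + r + int (t + m) * r"
    define D' where "D' = E + K + 1"
    have tmr: "0 \<le> int (t + m) * r" using radius_nonneg by simp
    define w1 where "w1 = shift (axis j (\<epsilon> * D)) x"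
    define w2 where "w2 = shift (axis j (- \<epsilon> * D')) x"
    define y where "y = patch {u. \<epsilon> * u $ j \<le> E} w1 w2"
    have y: "periodic_off {j} p y"
      unfolding y_def w1_def w2_def by (intro periodic_off_patch periodic_off_shift x) auto
    have quiet_left: "(c ^^ n) y u = z" if "m \<le> n" "\<bar>\<epsilon> * u $ j + D\<bar> \<le> r" for n u
    proof (rule quiet_after_translate[OF quiet y _ that(1), where w = "axis j (- \<epsilon> * D)"])
      fix w assume w: "w \<in> slab {j} K"
      have "axis j (- \<epsilon> * D) + axis j (\<epsilon> * D) = (0 :: int ^ 'd)"
        by (simp add: vec_eq_iff axis_def)
      then have "w1 (w + axis j (- \<epsilon> * D)) = x w"
        by (simp add: w1_def shift_apply add.assoc)
      moreover have "\<epsilon> * (w + axis j (- \<epsilon> * D)) $ j \<le> K - D"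
        using \<epsilon> w by (auto simp: slab_def)
      then have "\<epsilon> * (w + axis j (- \<epsilon> * D)) $ j \<le> E"
        using R K mr tmr radius_nonneg unfolding E_def D_def by linarith
      ultimately show "y (w + axis j (- \<epsilon> * D)) = x0 w"
        using w by (simp add: y_def patch_def x_def)
    qed (use that(2) \<epsilon> in \<open>auto simp: slab_def\<close>)
    have quiet_right: "(c ^^ n) y u = z" if "m \<le> n" "\<bar>\<epsilon> * u $ j - D'\<bar> \<le> r" for n u
    proof (rule quiet_after_translate[OF quiet y _ that(1), where w = "axis j (\<epsilon> * D')"])
      fix w assume w: "w \<in> slab {j} K"
      have "axis j (\<epsilon> * D') + axis j (- \<epsilon> * D') = (0 :: int ^ 'd)"
        by (simp add: vec_eq_iff axis_def)
      then have "w2 (w + axis j (\<epsilon> * D')) = x w"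
        by (simp add: w2_def shift_apply add.assoc)
      moreover have "\<not> \<epsilon> * (w + axis j (\<epsilon> * D')) $ j \<le> E"
        using \<epsilon> w by (auto simp: slab_def D'_def)
      ultimately show "y (w + axis j (\<epsilon> * D')) = x0 w"
        using w by (simp add: y_def patch_def x_def)
    qed (use that(2) \<epsilon> in \<open>auto simp: slab_def\<close>)
    have near_left: "(c ^^ n) y u = (c ^^ n) x (u + axis j (\<epsilon> * D))"
      if "n \<le> t + m" "\<epsilon> * u $ j \<le> D + r" for n u
    proof -
      have "(c ^^ n) y u = (c ^^ n) w1 u"
      proof (rule funpow_local)
        fix w assume "w \<in> cube u (int n * r)"
        then have "\<bar>w $ j - u $ j\<bar> \<le> int n * r" by (rule cubeD)
        also have "\<dots> \<le> int (t + m) * r"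
          using that(1) radius_nonneg by (intro mult_right_mono) auto
        finally have "\<epsilon> * w $ j \<le> E" using that(2) \<epsilon> by (auto simp: E_def)
        then show "y w = w1 w" by (simp add: y_def patch_def)
      qed
      then show ?thesis by (simp add: w1_def funpow_shift shift_apply)
    qed
    define H where "H = {u. - D < \<epsilon> * u $ j \<and> \<epsilon> * u $ j < D'}"
    define g where "g = patch H ((c ^^ m) y) blank"
    have orbit: "(c ^^ n) g = patch H ((c ^^ (n + m)) y) blank" for n
    proof -
      have "(c ^^ n) ((c ^^ m) y) u = z \<and> (c ^^ n) ((c ^^ m) y) w = z"
        if "u \<in> H" "w \<notin> H" "w \<in> cube u r" for n u w
      proof -
        have "\<bar>w $ j - u $ j\<bar> \<le> r" using that(3) by (rule cubeD)
        then have near: "\<bar>\<epsilon> * w $ j - \<epsilon> * u $ j\<bar> \<le> r" using \<epsilon> by auto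
        have "(\<bar>\<epsilon> * u $ j + D\<bar> \<le> r \<and> \<bar>\<epsilon> * w $ j + D\<bar> \<le> r) \<or>
          (\<bar>\<epsilon> * u $ j - D'\<bar> \<le> r \<and> \<bar>\<epsilon> * w $ j - D'\<bar> \<le> r)"
          using that(1,2) near unfolding H_def mem_Collect_eq by linarith
        then show ?thesis
          using quiet_left[of "n + m"] quiet_right[of "n + m"] by (auto simp: funpow_c_add)
      qed
      then show ?thesis unfolding g_def funpow_c_add by (rule cut_orbit)
    qed
    have outside: "vanishes (- slab {j} (max D D')) ((c ^^ n) g)" for n
      unfolding orbit using \<epsilon> by (auto simp: vanishes_def patch_def slab_def H_def)
    have g: "periodic_off {j} p g"
      unfolding g_def
      by (intro periodic_off_patch periodic_off_c y periodic_off_const) (auto simp: H_def)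
    have "bounded_in {j} g" using outside[of 0] unfolding bounded_in_def by auto
    moreover have "mortal g" by (rule confined_mortal[OF g p outside])
    moreover have "vanishes (slab {j} R) g"
      unfolding vanishes_def
    proof
      fix u assume u: "u \<in> slab {j} R"
      have "\<epsilon> * u $ j \<le> R" using u \<epsilon> by (auto simp: slab_def)
      then have "\<epsilon> * u $ j \<le> D + r" using K mr radius_nonneg unfolding D_def by linarith
      then have "(c ^^ m) y u = a (u + axis j (\<epsilon> * D))"
        using near_left[of m u] by (simp add: a_def)
      moreover have "u + axis j (\<epsilon> * D) \<notin> slab {j} (K + int m * r)"
        using u \<epsilon> radius_nonneg by (auto simp: slab_def D_def)
      ultimately show "g u = z" using a_outside by (simp add: g_def patch_def vanishes_def)
    qed
    ultimately have hit: "vanishes (slab {j} r) ((c ^^ t) g)" by (intro misses[OF g])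
    let ?u = "v - axis j (\<epsilon> * D)"
    have u: "\<bar>\<epsilon> * ?u $ j\<bar> \<le> r" using v \<epsilon> by auto
    then have "?u \<in> slab {j} r" using \<epsilon> by (auto simp: slab_def)
    with hit have "(c ^^ t) g ?u = z" by (rule vanishesD)
    moreover have "?u \<in> H"
      using u R K mr tmr radius_nonneg unfolding H_def mem_Collect_eq D'_def E_def D_def by linarith
    ultimately have "(c ^^ (t + m)) y ?u = z" by (simp add: orbit patch_def)
    moreover have "(c ^^ (t + m)) y ?u = (c ^^ (t + m)) x (?u + axis j (\<epsilon> * D))"
      by (rule near_left) (use u R K mr radius_nonneg in \<open>unfold D_def, linarith+\<close>)
    ultimately show ?thesis by (simp add: a_def funpow_c_add)
  qed
  define H where "H = {u :: int ^ 'd. \<bar>u $ j\<bar> < D}"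
  have "patch H a blank = a"
  proof
    fix u
    have "a u = z" if "u \<notin> H"
    proof (rule vanishesD[OF a_outside])
      show "u \<in> - slab {j} (K + int m * r)"
        using that R radius_nonneg by (auto simp: H_def slab_def D_def)
    qed
    then show "patch H a blank u = a u" by (auto simp: patch_def)
  qed
  moreover have "(c ^^ n) (patch H a blank) = patch H ((c ^^ n) a) blank" for n
  proof (rule cut_orbit)
    fix n v u assume vu: "v \<in> H" "u \<notin> H" "u \<in> cube v r"
    have "\<bar>u $ j - v $ j\<bar> \<le> r" using vu(3) by (rule cubeD)
    then have "(\<bar>1 * v $ j - D\<bar> \<le> r \<and> \<bar>1 * u $ j - D\<bar> \<le> r) \<or>
      (\<bar>(-1) * v $ j - D\<bar> \<le> r \<and> \<bar>(-1) * u $ j - D\<bar> \<le> r)"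
      using vu(1,2) unfolding H_def mem_Collect_eq by linarith
    then show "(c ^^ n) a v = z \<and> (c ^^ n) a u = z"
      using strip[of 1 _ n] strip[of "-1" _ n] by blast
  qed
  ultimately have "(c ^^ n) a = patch H ((c ^^ n) a) blank" for n by metis
  moreover have "vanishes (- slab {j} D) (patch H w blank)" for w
    by (auto simp: vanishes_def patch_def slab_def H_def)
  ultimately have "vanishes (- slab {j} D) ((c ^^ n) a)" for n by metis
  then have "mortal a" by (rule confined_mortal[OF a p])
  then show ?thesis unfolding a_def mortal_funpow x_def .
qed

section \<open>Several free directions: tubes of zeros\<close>

text \<open>
  Repeating the quiet pattern along direction j, with zeros elsewhere, gives a configuration with one free
  direction less, which is mortal by hypothesis. Hence a tube of zeros along j protects its axis
  forever.
\<close>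

lemma tube_block:
  assumes p: "1 \<le> p" and j: "j \<in> J"
    and IH: "\<And>q. 1 \<le> q \<Longrightarrow> \<exists>T. \<forall>x. periodic_off (J - {j}) q x \<longrightarrow> (c ^^ T) x = blank"
  shows "\<exists>M. \<forall>g. periodic_off J p g \<longrightarrow> vanishes (slab (J - {j}) M) g \<longrightarrow> (\<forall>t. (c ^^ t) g 0 = z)"
proof -
  obtain x0 K m where K: "0 \<le> K" and x0: "periodic_off J p x0" and quiet: "quiet_after J p 0 x0 K m"
    using quiet_pattern_exists[OF p] by blast
  define q where "q = p * (2 * K + 1)"
  have q: "2 * K + 1 \<le> q" "p dvd q"
    unfolding q_def using p K mult_right_mono[of 1 p "2 * K + 1"] by auto
  then have q1: "1 \<le> q" using K by linarith
  \<comment> \<open>Direction j is folded onto the window from -K to \<open>q - K - 1\<close>, which contains the whole pattern because \<open>q\<close> is at least \<open>2 * K + 1\<close>; as a multiple of p, the new period q serves the other directions as well.\<close>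
  define fold where "fold v = (\<chi> i. if i = j then (v $ j + K) mod q - K else v $ i)" for v :: "int ^ 'd"
  define x where "x = patch (slab (J - {j}) K) (\<lambda>v. x0 (fold v)) blank"
  have fold_dvd: "p dvd fold w $ i - fold v $ i"
    if "p dvd w $ i - v $ i" for v w i
  proof (cases "i = j")
    case True
    have "p dvd (u $ j + K) mod q - K - u $ j" for u :: "int ^ 'd"
    proof -
      have "(u $ j + K) mod q - K - u $ j = - (q * ((u $ j + K) div q))"
        by (simp add: minus_mult_div_eq_mod[symmetric])
      then show ?thesis using q(2) by simp
    qed
    from dvd_add[OF dvd_diff[OF this[of w] this[of v]] that] True show ?thesis
      by (simp add: fold_def)
  qed (use that in \<open>simp add: fold_def\<close>)
  have per_pq: "periodic_off (J - {j}) q x"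
    unfolding periodic_off_def
  proof (intro allI impI)
    fix v w assume vw: "\<forall>i\<in>J - {j}. w $ i = v $ i" "\<forall>i. q dvd w $ i - v $ i"
    have "q dvd (w $ j + K) - (v $ j + K)" using vw(2) by simp
    then have "(w $ j + K) mod q = (v $ j + K) mod q" by (simp add: mod_eq_dvd_iff)
    then have "x0 (fold w) = x0 (fold v)"
      using vw q(2) by (intro periodic_offD[OF x0] fold_dvd) (auto simp: fold_def intro: dvd_trans)
    moreover have "w \<in> slab (J - {j}) K \<longleftrightarrow> v \<in> slab (J - {j}) K"
      using vw(1) by (simp add: slab_def)
    ultimately show "x w = x v" by (simp add: x_def patch_def)
  qed
  have "periodic_off J p (\<lambda>v. x0 (fold v))"
    unfolding periodic_off_def
    by (intro allI impI periodic_offD[OF x0] fold_dvd) (use j in \<open>auto simp: fold_def\<close>)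
  then have "periodic_off J p x"
    unfolding x_def by (rule periodic_off_patch_slab[OF _ periodic_off_const]) blast
  moreover have "x v = x0 v" if "v \<in> slab J K" for v
  proof -
    have "0 \<le> v $ j + K" "v $ j + K < q" using that j q(1) by (auto simp: slab_def)
    then have "fold v = v" by (simp add: fold_def vec_eq_iff)
    moreover have "v \<in> slab (J - {j}) K" using that by (simp add: slab_def)
    ultimately show ?thesis by (simp add: x_def patch_def)
  qed
  moreover have "vanishes (- slab (J - {j}) K) x" by (simp add: vanishes_def x_def patch_def)
  moreover have "mortal x" using IH[OF q1] per_pq unfolding mortal_def by blast
  ultimately obtain M where M: "\<And>g t. periodic_off J p g \<Longrightarrow> vanishes (slab (J - {j}) M) g \<Longrightarrow>
      vanishes (slab J 0) ((c ^^ t) g)"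
    using block[OF quiet, of "J - {j}" x] by blast
  have "0 \<in> slab J 0" by (simp add: slab_def)
  then show ?thesis using M vanishesD by blast
qed

text \<open>
  A cell v far from the support of x is far away in some free direction i. The tube through v along another
  free direction j keeps this distance, so it misses the support and v stays zero. Thus the orbit of x
  remains bounded.
\<close>

lemma bounded_mortal_several_directions:
  assumes p: "1 \<le> p" and J: "\<And>i. i \<in> J \<Longrightarrow> J - {i} \<noteq> {}"
    and IH: "\<And>j q. j \<in> J \<Longrightarrow> 1 \<le> q \<Longrightarrow> \<exists>T. \<forall>x. periodic_off (J - {j}) q x \<longrightarrow> (c ^^ T) x = blank"
    and x: "periodic_off J p x" "bounded_in J x"
  shows "mortal x"
proof -
  have "\<exists>M. \<forall>g. periodic_off J p g \<longrightarrow> vanishes (slab (J - {j}) M) g \<longrightarrow> (\<forall>t. (c ^^ t) g 0 = z)"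
    if "j \<in> J" for j
    using tube_block[OF p that IH[OF that]] by blast
  then obtain M where M: "\<And>j g t. j \<in> J \<Longrightarrow> periodic_off J p g \<Longrightarrow>
      vanishes (slab (J - {j}) (M j)) g \<Longrightarrow> (c ^^ t) g 0 = z"
    by metis
  define N where "N = (\<Sum>j\<in>J. \<bar>M j\<bar>)"
  have N: "M j \<le> N" if "j \<in> J" for j
  proof -
    have "\<bar>M j\<bar> \<le> N" unfolding N_def by (rule member_le_sum) (use that in auto)
    then show ?thesis by linarith
  qed
  obtain L where L: "vanishes (- slab J L) x" using x(2) unfolding bounded_in_def by blast
  have "vanishes (- slab J (L + N)) ((c ^^ n) x)" for n
    unfolding vanishes_def
  proof
    fix v assume "v \<in> - slab J (L + N)"
    then obtain i where i: "i \<in> J" "L + N < \<bar>v $ i\<bar>" by (auto simp: slab_def)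
    obtain j where j: "j \<in> J" "j \<noteq> i" using J[OF i(1)] by blast
    have "vanishes (slab (J - {j}) (M j)) (shift v x)"
      unfolding vanishes_def
    proof
      fix u assume "u \<in> slab (J - {j}) (M j)"
      then have "\<bar>u $ i\<bar> \<le> N" using i(1) j N[of j] by (force simp: slab_def)
      then have "L < \<bar>(u + v) $ i\<bar>" using i(2) by simp
      then have "u + v \<in> - slab J L" using i(1) by (force simp: slab_def)
      with L have "x (u + v) = z" by (rule vanishesD)
      then show "shift v x u = z" by (simp add: shift_apply)
    qed
    then have "(c ^^ n) (shift v x) 0 = z"
      by (rule M[OF j(1) periodic_off_shift[OF x(1)]])
    then show "(c ^^ n) x v = z" by (simp add: funpow_shift shift_apply)
  qed
  then show ?thesis by (rule confined_mortal[OF x(1) p])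
qed

section \<open>Induction on the number of free directions\<close>

text \<open>
  With no free direction, a configuration that vanishes on a slab is zero, so nothing can ever reach the
  origin.
\<close>

lemma nilpotent_on_periodic:
  assumes "1 \<le> p"
  shows "\<exists>T. \<forall>x. periodic_off J p x \<longrightarrow> (c ^^ T) x = blank"
  using finite[of J] assms
proof (induction J arbitrary: p rule: finite_psubset_induct)
  case (psubset J)
  note p = psubset.prems
  show ?case
  proof (cases "J = {}")
    case True
    have "(c ^^ n) x 0 = z" if "vanishes (slab J 0) x" for x n
      using that funpow_vanish[of 0 n x] by (simp add: True slab_def vanishes_def)
    then show ?thesis using uniformly_mortal[OF p] by blast
  next
    case False
    obtain x0 K m where K: "0 \<le> K" and x0: "periodic_off J p x0" and quiet: "quiet_after J p r x0 K m"
      using quiet_pattern_exists[OF p] by blast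
    have "mortal (patch (slab J K) x0 blank)"
    proof (cases "\<exists>j. J = {j}")
      case True
      then obtain j where "J = {j}" by blast
      then show ?thesis using pattern_mortal_one_direction[OF p K] x0 quiet by simp
    next
      case several: False
      show ?thesis
      proof (rule bounded_mortal_several_directions[OF p])
        show "J - {i} \<noteq> {}" if "i \<in> J" for i using several that by blast
        show "\<exists>T. \<forall>x. periodic_off (J - {j}) q x \<longrightarrow> (c ^^ T) x = blank" if "j \<in> J" "1 \<le> q" for j q
          using psubset.IH[of "J - {j}" q] that by blast
        show "periodic_off J p (patch (slab J K) x0 blank)"
          by (rule periodic_off_patch_slab[OF x0 periodic_off_const order_refl])
        show "bounded_in J (patch (slab J K) x0 blank)"
          unfolding bounded_in_def vanishes_def by (intro exI[of _ K]) (simp add: patch_def)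
      qed
    qed
    then show ?thesis by (rule nilpotent_if_mortal_pattern[OF p radius_nonneg quiet x0])
  qed
qed

end

theorem theorem2:
  fixes c :: "('d::finite, 's::finite) config \<Rightarrow> ('d, 's) config"
    and z :: 's
  assumes "cellular_automaton c"
    and "asymptotically_nilpotent z c"
  shows "nilpotent z c"
proof -
  obtain r where r: "0 \<le> r" "\<And>v x y. (\<And>u. u \<in> cube v r \<Longrightarrow> x u = y u) \<Longrightarrow> c x v = c y v"
    using cellular_automaton_radius[OF assms(1)] by blast
  interpret asymptotic_automaton c z r
  proof
    show "0 \<le> r" by (rule r(1))
    show "c x v = c y v" if "\<And>u. u \<in> cube v r \<Longrightarrow> x u = y u" for v x y
      using that by (rule r(2))
    show "c (shift w x) = shift w (c x)" for w x
      using assms(1) unfolding cellular_automaton_def by (metis comp_apply)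
    show "\<exists>m. \<forall>n\<ge>m. (c ^^ n) x v = z" for x v
      using assms(2) unfolding asymptotically_nilpotent_def by blast
  qed
  have "periodic_off UNIV 1 x" for x :: "('d, 's) config"
    by (auto simp: periodic_off_def simp flip: vec_eq_iff)
  then obtain T where "\<And>x. (c ^^ T) x = blank"
    using nilpotent_on_periodic[of 1 UNIV] by auto
  then show ?thesis
    unfolding nilpotent_def using dead_stays_dead by (metis (full_types))
qed

end
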